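(* Let $k$ be an algebraically closed field of characteristic zero, let $G$ be a finite group with identity $e$, let $F\subseteq G$ be a subgroup, and let $Q\subseteq G$ be a subset with $e\in Q$ which is simultaneously a set of representatives of the cosets $Fg$ and of the cosets $gF$ ($g\in G$). Let $\omega: G\times G\times G\to k^{\times}$ be a normalized 3-cocycle such that $\omega(x,y,z)=1$ for all $x,y,z\in F$. Then there exists a normalized 2-cochain $\eta: G\times G\to k^{\times}$ such that $\eta|_{F\times F}=1$ and $$\omega(d\eta)|_{F\times G\times G}=1=\omega(d\eta)|_{G\times F\times Q}.$$
   Context: A normalized 3-cocycle is a map $\omega:G\times G\times G\to k^\times$ with $\omega(ab,c,d)\,\omega(a,b,cd)=\omega(a,b,c)\,\omega(a,bc,d)\,\omega(b,c,d)$ and $\omega(e,a,b)=\omega(a,e,b)=\omega(a,b,e)=1$ for all $a,b,c,d\in G$. A normalized 2-cochain is a map $\eta:G\times G\to k^\times$ with $\eta(e,g)=\eta(g,e)=1$ for all $g \in G$. Its coboundary is $(d\eta)(a,b,c)=\eta(ab,c)\,\eta(a,b)\,\eta(b,c)^{-1}\,\eta(a,bc)^{-1}$. The product $\omega(d\eta)$ is pointwise. *)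

theory Defs
  imports
    "HOL-Algebra.Left_Coset"
    "HOL-Computational_Algebra.Polynomial"
begin

text \<open>
  Cochains on a group \<open>G\<close> with values in the unit group of a field \<open>'k\<close> are functions on the
  underlying type whose values on \<open>carrier G\<close> are nonzero; their values elsewhere are irrelevant.
\<close>

definition normalized_2cochain :: "('a, 'b) monoid_scheme \<Rightarrow> ('a \<Rightarrow> 'a \<Rightarrow> 'k::field) \<Rightarrow> bool" where
  "normalized_2cochain G \<eta> \<longleftrightarrow>
     (\<forall>a\<in>carrier G. \<forall>b\<in>carrier G. \<eta> a b \<noteq> 0) \<and>
     (\<forall>g\<in>carrier G. \<eta> \<one>\<^bsub>G\<^esub> g = 1 \<and> \<eta> g \<one>\<^bsub>G\<^esub> = 1)"

definition normalized_3cocycle :: "('a, 'b) monoid_scheme \<Rightarrow> ('a \<Rightarrow> 'a \<Rightarrow> 'a \<Rightarrow> 'k::field) \<Rightarrow> bool" where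
  "normalized_3cocycle G \<omega> \<longleftrightarrow>
     (\<forall>a\<in>carrier G. \<forall>b\<in>carrier G. \<forall>c\<in>carrier G. \<omega> a b c \<noteq> 0) \<and>
     (\<forall>a\<in>carrier G. \<forall>b\<in>carrier G. \<forall>c\<in>carrier G. \<forall>d\<in>carrier G.
        \<omega> (a \<otimes>\<^bsub>G\<^esub> b) c d * \<omega> a b (c \<otimes>\<^bsub>G\<^esub> d) = \<omega> a b c * \<omega> a (b \<otimes>\<^bsub>G\<^esub> c) d * \<omega> b c d) \<and>
     (\<forall>a\<in>carrier G. \<forall>b\<in>carrier G.
        \<omega> \<one>\<^bsub>G\<^esub> a b = 1 \<and> \<omega> a \<one>\<^bsub>G\<^esub> b = 1 \<and> \<omega> a b \<one>\<^bsub>G\<^esub> = 1)"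

definition coboundary :: "('a, 'b) monoid_scheme \<Rightarrow> ('a \<Rightarrow> 'a \<Rightarrow> 'k::field) \<Rightarrow> 'a \<Rightarrow> 'a \<Rightarrow> 'a \<Rightarrow> 'k" where
  "coboundary G \<eta> a b c =
     \<eta> (a \<otimes>\<^bsub>G\<^esub> b) c * \<eta> a b * inverse (\<eta> b c) * inverse (\<eta> a (b \<otimes>\<^bsub>G\<^esub> c))"

definition representatives :: "'a set \<Rightarrow> 'a set set \<Rightarrow> bool" where
  "representatives Q \<C> \<longleftrightarrow> (\<forall>C\<in>\<C>. \<exists>!q. q \<in> Q \<and> q \<in> C)"

end

theory Submission
  imports Defs
begin

text \<open>
  Factor every \<open>g \<in> G\<close> as \<open>\<phi> g \<otimes> \<kappa> g\<close> with \<open>\<phi> g \<in> F\<close>, \<open>\<kappa> g \<in> Q\<close>.  Since \<open>\<omega>\<close> is trivial on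
  \<open>F\<close>, the cochain \<open>A x g = \<omega> x (\<phi> g) (\<kappa> g)\<close> on \<open>F \<times> G\<close> trivializes \<open>\<omega>\<close> on \<open>F \<times> F \<times> G\<close>.
  The condition on \<open>F \<times> G \<times> G\<close> forces \<open>\<eta> (x \<otimes> p) h = \<eta> p h * A x (p \<otimes> h) / \<omega> x p h\<close>
  for \<open>x \<in> F\<close>, \<open>p \<in> Q\<close>, and by the cocycle identity this prescription suffices, whatever the values
  on \<open>Q \<times> G\<close>.  The cocycle identity also reduces the condition on \<open>G \<times> F \<times> Q\<close> to \<open>Q \<times> F \<times> Q\<close>;
  setting \<open>\<eta> = 1\<close> on \<open>Q \<times> F\<close> and \<open>Q \<times> Q\<close>, it reads
  \<open>\<eta> p (f \<otimes> q) = \<omega> p f q * \<eta> (p \<otimes> f) q\<close>, which defines the restriction \<open>B\<close>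
  of \<open>\<eta>\<close> to \<open>Q \<times> G\<close>.
\<close>

locale factorized_cocycle = group G for G (structure) +
  fixes F Q :: "'a set" and \<phi> \<kappa> :: "'a \<Rightarrow> 'a" and \<omega> :: "'a \<Rightarrow> 'a \<Rightarrow> 'a \<Rightarrow> 'k::field"
  assumes subgroup_F: "subgroup F G"
    and Q_closed: "Q \<subseteq> carrier G" and one_Q: "\<one> \<in> Q"
    and \<phi>_F: "g \<in> carrier G \<Longrightarrow> \<phi> g \<in> F"
    and \<kappa>_Q: "g \<in> carrier G \<Longrightarrow> \<kappa> g \<in> Q"
    and factor: "g \<in> carrier G \<Longrightarrow> \<phi> g \<otimes> \<kappa> g = g"
    and \<phi>_mult: "x \<in> F \<Longrightarrow> q \<in> Q \<Longrightarrow> \<phi> (x \<otimes> q) = x"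
    and \<kappa>_mult: "x \<in> F \<Longrightarrow> q \<in> Q \<Longrightarrow> \<kappa> (x \<otimes> q) = q"
    and cocycle: "normalized_3cocycle G \<omega>"
    and trivial_F: "x \<in> F \<Longrightarrow> y \<in> F \<Longrightarrow> z \<in> F \<Longrightarrow> \<omega> x y z = 1"
begin

lemma F_carrier [simp]: "x \<in> F \<Longrightarrow> x \<in> carrier G"
  using subgroup_F subgroup.mem_carrier by metis

lemma Q_carrier [simp]: "q \<in> Q \<Longrightarrow> q \<in> carrier G"
  using Q_closed by auto

lemma F_mult [simp]: "x \<in> F \<Longrightarrow> y \<in> F \<Longrightarrow> x \<otimes> y \<in> F"
  using subgroup_F subgroup.m_closed by metis

lemma one_F [simp]: "\<one> \<in> F"
  using subgroup_F subgroup.one_closed by metis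

declare one_Q [simp] \<phi>_F [simp] \<kappa>_Q [simp] factor [simp] \<phi>_mult [simp] \<kappa>_mult [simp]

lemma factor_F [simp]: "x \<in> F \<Longrightarrow> \<phi> x = x" "x \<in> F \<Longrightarrow> \<kappa> x = \<one>"
  using \<phi>_mult[of x \<one>] \<kappa>_mult[of x \<one>] by auto

lemma factor_Q [simp]: "q \<in> Q \<Longrightarrow> \<phi> q = \<one>" "q \<in> Q \<Longrightarrow> \<kappa> q = q"
  using \<phi>_mult[of \<one> q] \<kappa>_mult[of \<one> q] by auto

lemma factor_F_mult [simp]:
  assumes "x \<in> F" "g \<in> carrier G"
  shows "\<phi> (x \<otimes> g) = x \<otimes> \<phi> g" "\<kappa> (x \<otimes> g) = \<kappa> g"
proof -
  have "x \<otimes> g = (x \<otimes> \<phi> g) \<otimes> \<kappa> g"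
    using assms by (simp add: m_assoc)
  then show "\<phi> (x \<otimes> g) = x \<otimes> \<phi> g" "\<kappa> (x \<otimes> g) = \<kappa> g"
    using assms by (simp_all del: factor)
qed

lemma \<omega>_nonzero [simp]:
  "a \<in> carrier G \<Longrightarrow> b \<in> carrier G \<Longrightarrow> c \<in> carrier G \<Longrightarrow> \<omega> a b c \<noteq> 0"
  using cocycle by (simp add: normalized_3cocycle_def)

lemma \<omega>_one [simp]:
  assumes "a \<in> carrier G" "b \<in> carrier G"
  shows "\<omega> \<one> a b = 1" "\<omega> a \<one> b = 1" "\<omega> a b \<one> = 1"
  using cocycle assms by (simp_all add: normalized_3cocycle_def)

lemma \<omega>_cocycle:
  assumes "a \<in> carrier G" "b \<in> carrier G" "c \<in> carrier G" "d \<in> carrier G"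
  shows "\<omega> (a \<otimes> b) c d * \<omega> a b (c \<otimes> d) = \<omega> a b c * \<omega> a (b \<otimes> c) d * \<omega> b c d"
  using cocycle assms by (simp add: normalized_3cocycle_def)

definition A :: "'a \<Rightarrow> 'a \<Rightarrow> 'k" where
  "A x g = \<omega> x (\<phi> g) (\<kappa> g)"

text \<open>The quotient of \<open>trivializer (x \<otimes> q) h\<close> by
  \<open>trivializer q h\<close> that triviality at \<open>(x, q, h)\<close> forces;
  \<open>trivializer x q\<close> does not appear in it because \<open>A x q = 1\<close>.\<close>

definition ratio :: "'a \<Rightarrow> 'a \<Rightarrow> 'a \<Rightarrow> 'k" where
  "ratio x q h = A x (q \<otimes> h) / \<omega> x q h"

text \<open>The second factor is the future
  \<open>trivializer (p \<otimes> \<phi> h) (\<kappa> h)\<close>, written out with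
  \<open>B = 1\<close> on pairs from \<open>Q\<close>; this avoids a recursive definition.\<close>

definition B :: "'a \<Rightarrow> 'a \<Rightarrow> 'k" where
  "B p h = \<omega> p (\<phi> h) (\<kappa> h) * ratio (\<phi> (p \<otimes> \<phi> h)) (\<kappa> (p \<otimes> \<phi> h)) (\<kappa> h)"

definition trivializer :: "'a \<Rightarrow> 'a \<Rightarrow> 'k" where
  "trivializer g h = B (\<kappa> g) h * ratio (\<phi> g) (\<kappa> g) h"

lemma A_nonzero [simp]: "x \<in> F \<Longrightarrow> g \<in> carrier G \<Longrightarrow> A x g \<noteq> 0"
  by (simp add: A_def)

lemma A_Q [simp]: "x \<in> F \<Longrightarrow> q \<in> Q \<Longrightarrow> A x q = 1"
  by (simp add: A_def)

lemma A_F [simp]: "x \<in> F \<Longrightarrow> y \<in> F \<Longrightarrow> A x y = 1"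
  by (simp add: A_def)

lemma A_one [simp]: "g \<in> carrier G \<Longrightarrow> A \<one> g = 1"
  by (simp add: A_def)

text \<open>The cocycle identity at \<open>(f, x, \<phi> g, \<kappa> g)\<close>, where
  \<open>\<omega> f x (\<phi> g) = 1\<close> since all three arguments lie in
  \<open>F\<close>.\<close>

lemma A_trivializes:
  assumes "f \<in> F" "x \<in> F" "g \<in> carrier G"
  shows "\<omega> f x g * A (f \<otimes> x) g = A x g * A f (x \<otimes> g)"
  using \<omega>_cocycle[of f x "\<phi> g" "\<kappa> g"] assms
  by (simp add: A_def trivial_F mult.commute)

lemma ratio_nonzero [simp]:
  "x \<in> F \<Longrightarrow> q \<in> Q \<Longrightarrow> h \<in> carrier G \<Longrightarrow> ratio x q h \<noteq> 0"
  by (simp add: ratio_def)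

lemma ratio_one [simp]:
  "q \<in> Q \<Longrightarrow> h \<in> carrier G \<Longrightarrow> ratio \<one> q h = 1"
  "x \<in> F \<Longrightarrow> q \<in> Q \<Longrightarrow> ratio x q \<one> = 1"
  "x \<in> F \<Longrightarrow> h \<in> carrier G \<Longrightarrow> ratio x \<one> h = A x h"
  by (simp_all add: ratio_def)

lemma B_nonzero [simp]: "p \<in> Q \<Longrightarrow> h \<in> carrier G \<Longrightarrow> B p h \<noteq> 0"
  by (simp add: B_def)

lemma B_Q [simp]: "p \<in> Q \<Longrightarrow> q \<in> Q \<Longrightarrow> B p q = 1"
  by (simp add: B_def)

lemma B_F [simp]: "p \<in> Q \<Longrightarrow> f \<in> F \<Longrightarrow> B p f = 1"
  by (simp add: B_def)

lemma B_one [simp]: "h \<in> carrier G \<Longrightarrow> B \<one> h = 1"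
  by (simp add: B_def)

lemma trivializer_nonzero [simp]:
  "g \<in> carrier G \<Longrightarrow> h \<in> carrier G \<Longrightarrow> trivializer g h \<noteq> 0"
  by (simp add: trivializer_def)

lemma trivializer_F [simp]: "x \<in> F \<Longrightarrow> h \<in> carrier G \<Longrightarrow> trivializer x h = A x h"
  by (simp add: trivializer_def)

lemma trivializer_Q [simp]: "p \<in> Q \<Longrightarrow> h \<in> carrier G \<Longrightarrow> trivializer p h = B p h"
  by (simp add: trivializer_def)

lemma trivializer_one [simp]: "g \<in> carrier G \<Longrightarrow> trivializer g \<one> = 1"
  by (simp add: trivializer_def)

lemma normalized_trivializer: "normalized_2cochain G trivializer"
  by (simp add: normalized_2cochain_def)

text \<open>Triviality at \<open>(f, x \<otimes> q, h)\<close> after cancelling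
  \<open>B q h\<close>. It combines the cocycle identity at \<open>(f, x, q, h)\<close> with
  \<open>A_trivializes\<close> at \<open>(f, x, q \<otimes> h)\<close>.\<close>

lemma ratio_mult:
  assumes f: "f \<in> F" and x: "x \<in> F" and q: "q \<in> Q" and h: "h \<in> carrier G"
  shows "\<omega> f (x \<otimes> q) h * ratio (f \<otimes> x) q h * A f (x \<otimes> q) = ratio x q h * A f (x \<otimes> (q \<otimes> h))"
proof -
  have "\<omega> f x q = A f (x \<otimes> q)"
    using A_trivializes[of f x q] f x q by simp
  then have "\<omega> (f \<otimes> x) q h * \<omega> f x (q \<otimes> h) = A f (x \<otimes> q) * \<omega> f (x \<otimes> q) h * \<omega> x q h"
    using \<omega>_cocycle[of f x q h] f x q h by simp
  moreover have "\<omega> f x (q \<otimes> h) * A (f \<otimes> x) (q \<otimes> h) = A x (q \<otimes> h) * A f (x \<otimes> (q \<otimes> h))"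
    using A_trivializes[of f x "q \<otimes> h"] f x q h by simp
  moreover have "\<omega> (f \<otimes> x) q h \<noteq> 0" "\<omega> x q h \<noteq> 0"
    using f x q h by simp_all
  ultimately show ?thesis
    unfolding ratio_def by (simp add: divide_simps) algebra
qed

text \<open>Since \<open>g\<close> and \<open>f \<otimes> g\<close> have the same
  \<open>Q\<close>-part, both sides contain the factor \<open>B (\<kappa> g) h\<close>, so its
  values do not matter.\<close>

lemma trivializer_FGG:
  assumes "f \<in> F" "g \<in> carrier G" "h \<in> carrier G"
  shows "\<omega> f g h * trivializer (f \<otimes> g) h * trivializer f g
       = trivializer g h * trivializer f (g \<otimes> h)"
proof -
  have "\<phi> g \<otimes> (\<kappa> g \<otimes> h) = g \<otimes> h"
    using assms by (simp flip: m_assoc)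
  then show ?thesis
    using ratio_mult[of f "\<phi> g" "\<kappa> g" h] assms
    by (simp add: trivializer_def[of g] trivializer_def[of "f \<otimes> g"] mult.assoc)
qed

lemma trivializer_QFQ:
  assumes "p \<in> Q" "f \<in> F" "q \<in> Q"
  shows "trivializer p (f \<otimes> q) = \<omega> p f q * trivializer (p \<otimes> f) q * trivializer p f"
  using assms by (simp add: B_def[of p "f \<otimes> q"] trivializer_def[of "p \<otimes> f"])

text \<open>The product of \<open>\<omega>\<close> with the coboundary is again a cocycle. In its
  identity at \<open>(x, p, f, q)\<close>, the three terms with first argument \<open>x\<close> are
  trivial by \<open>trivializer_FGG\<close>, so the value at \<open>(x \<otimes> p, f, q)\<close>
  equals that at \<open>(p, f, q)\<close>, which is 1 by \<open>trivializer_QFQ\<close>.\<close>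

lemma trivializer_GFQ:
  assumes g: "g \<in> carrier G" and f: "f \<in> F" and q: "q \<in> Q"
  shows "\<omega> g f q * trivializer (g \<otimes> f) q * trivializer g f
       = trivializer f q * trivializer g (f \<otimes> q)"
proof -
  define x p where "x = \<phi> g" and "p = \<kappa> g"
  have x: "x \<in> F" and p: "p \<in> Q" and g_eq: "g = x \<otimes> p"
    using g by (simp_all add: x_def p_def)
  let ?t = trivializer
  have "\<omega> x p (f \<otimes> q) * ?t g (f \<otimes> q) = ?t p (f \<otimes> q) * ?t x (p \<otimes> f \<otimes> q)"
    using trivializer_FGG[of x p "f \<otimes> q"] x p f q by (simp add: g_eq m_assoc)
  moreover have "\<omega> x (p \<otimes> f) q * ?t (g \<otimes> f) q * ?t x (p \<otimes> f)
      = ?t (p \<otimes> f) q * ?t x (p \<otimes> f \<otimes> q)"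
    using trivializer_FGG[of x "p \<otimes> f" q] x p f q by (simp add: g_eq m_assoc)
  moreover have "\<omega> x p f * ?t g f = ?t p f * ?t x (p \<otimes> f)"
    using trivializer_FGG[of x p f] x p f by (simp add: g_eq)
  moreover have "\<omega> g f q * \<omega> x p (f \<otimes> q) = \<omega> x p f * \<omega> x (p \<otimes> f) q * \<omega> p f q"
    using \<omega>_cocycle[of x p f q] x p f q by (simp add: g_eq)
  moreover note trivializer_QFQ[OF p f q]
  moreover have "?t x (p \<otimes> f) \<noteq> 0" "\<omega> x p (f \<otimes> q) \<noteq> 0" "\<omega> x p f \<noteq> 0" "\<omega> x (p \<otimes> f) q \<noteq> 0"
    using x p f q by (simp_all del: trivializer_F)
  ultimately have "\<omega> g f q * ?t (g \<otimes> f) q * ?t g f = ?t g (f \<otimes> q)"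
    by algebra
  \<comment> \<open>The remaining factor \<open>trivializer f q\<close> is
    \<open>A f q = 1\<close>.\<close>
  then show ?thesis
    using f q by simp
qed

end

text \<open>Clears the inverses, giving the form in which the conditions on
  \<open>trivializer\<close> are proved.\<close>

lemma (in group) mult_coboundary_eq_1_iff:
  fixes \<omega> :: "'a \<Rightarrow> 'a \<Rightarrow> 'a \<Rightarrow> 'k::field"
  assumes "normalized_2cochain G \<eta>" "a \<in> carrier G" "b \<in> carrier G" "c \<in> carrier G"
  shows "\<omega> a b c * coboundary G \<eta> a b c = 1
     \<longleftrightarrow> \<omega> a b c * \<eta> (a \<otimes> b) c * \<eta> a b = \<eta> b c * \<eta> a (b \<otimes> c)"
proof -
  have "\<eta> b c \<noteq> 0" "\<eta> a (b \<otimes> c) \<noteq> 0"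
    using assms by (simp_all add: normalized_2cochain_def)
  then show ?thesis
    by (simp add: coboundary_def field_simps)
qed

lemma (in group) right_transversal_factorization:
  assumes F: "subgroup F G" and Q: "Q \<subseteq> carrier G" and rep: "representatives Q (rcosets F)"
  obtains \<phi> \<kappa> where
    "\<And>g. g \<in> carrier G \<Longrightarrow> \<phi> g \<in> F \<and> \<kappa> g \<in> Q \<and> \<phi> g \<otimes> \<kappa> g = g"
    "\<And>x q. x \<in> F \<Longrightarrow> q \<in> Q \<Longrightarrow> \<phi> (x \<otimes> q) = x \<and> \<kappa> (x \<otimes> q) = q"
proof -
  interpret F: subgroup F G by (rule F)
  have uniq: "\<exists>!q. q \<in> Q \<and> q \<in> F #> g" if "g \<in> carrier G" for g
    using rep rcosetsI[OF F.subset that] by (auto simp: representatives_def)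
  \<comment> \<open>The \<open>Q\<close>-part of \<open>g\<close> is the representative of its right
    coset; writing it as \<open>y \<otimes> g\<close> with \<open>y\<close> in \<open>F\<close>
    makes the complementary factor \<open>inv y\<close>, again in \<open>F\<close>.\<close>
  define \<kappa> where "\<kappa> g = (THE q. q \<in> Q \<and> q \<in> F #> g)" for g
  define \<phi> where "\<phi> g = g \<otimes> inv (\<kappa> g)" for g
  have \<kappa>: "\<kappa> g \<in> Q" "\<kappa> g \<in> F #> g" if "g \<in> carrier G" for g
    using theI'[OF uniq[OF that]] by (auto simp: \<kappa>_def)
  show ?thesis
  proof
    fix g assume g: "g \<in> carrier G"
    obtain y where y: "y \<in> F" "\<kappa> g = y \<otimes> g"
      using \<kappa>(2)[OF g] by (auto simp: r_coset_def)
    have "\<phi> g = inv y"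
      using y g by (simp add: \<phi>_def inv_mult_group flip: m_assoc)
    then show "\<phi> g \<in> F \<and> \<kappa> g \<in> Q \<and> \<phi> g \<otimes> \<kappa> g = g"
      using y g \<kappa>(1)[OF g] by (simp flip: m_assoc)
  next
    fix x q assume x: "x \<in> F" and q: "q \<in> Q"
    then have qG: "q \<in> carrier G" using Q by auto
    have "q = inv x \<otimes> (x \<otimes> q)"
      using x qG by (simp flip: m_assoc)
    then have "q \<in> F #> (x \<otimes> q)"
      using x unfolding r_coset_def by blast
    then have "\<kappa> (x \<otimes> q) = q"
      unfolding \<kappa>_def using uniq[of "x \<otimes> q"] x q qG by (intro the1_equality) auto
    then show "\<phi> (x \<otimes> q) = x \<and> \<kappa> (x \<otimes> q) = q"
      using x qG by (simp add: \<phi>_def m_assoc)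
  qed
qed

theorem proposition4p2:
  fixes G :: "('a, 'b) monoid_scheme" (structure)
    and F Q :: "'a set"
    and \<omega> :: "'a \<Rightarrow> 'a \<Rightarrow> 'a \<Rightarrow> 'k :: {alg_closed_field, field_char_0}"
  assumes "group G" and "finite (carrier G)"
    and "subgroup F G"
    and "Q \<subseteq> carrier G" and "\<one> \<in> Q"
    and "representatives Q (rcosets F)" and "representatives Q (lcosets F)"
    and "normalized_3cocycle G \<omega>"
    and "\<forall>x\<in>F. \<forall>y\<in>F. \<forall>z\<in>F. \<omega> x y z = 1"
  shows "\<exists>\<eta> :: 'a \<Rightarrow> 'a \<Rightarrow> 'k.
           normalized_2cochain G \<eta> \<and>
           (\<forall>x\<in>F. \<forall>y\<in>F. \<eta> x y = 1) \<and>
           (\<forall>f\<in>F. \<forall>g\<in>carrier G. \<forall>h\<in>carrier G. \<omega> f g h * coboundary G \<eta> f g h = 1) \<and>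
           (\<forall>g\<in>carrier G. \<forall>f\<in>F. \<forall>q\<in>Q. \<omega> g f q * coboundary G \<eta> g f q = 1)"
proof -
  interpret group G by fact
  obtain \<phi> \<kappa> where
    "\<And>g. g \<in> carrier G \<Longrightarrow> \<phi> g \<in> F \<and> \<kappa> g \<in> Q \<and> \<phi> g \<otimes> \<kappa> g = g"
    "\<And>x q. x \<in> F \<Longrightarrow> q \<in> Q \<Longrightarrow> \<phi> (x \<otimes> q) = x \<and> \<kappa> (x \<otimes> q) = q"
    using right_transversal_factorization assms(3,4,6) by blast
  then interpret factorized_cocycle G F Q \<phi> \<kappa> \<omega>
    using assms by (intro factorized_cocycle.intro factorized_cocycle_axioms.intro) auto
  show ?thesis
    \<comment> \<open>On pairs from \<open>F\<close> the cochain is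
      \<open>A x y = \<omega> x y \<one> = 1\<close> by normalization of
      \<open>\<omega>\<close>.\<close>
    using normalized_trivializer trivializer_FGG trivializer_GFQ
    by (intro exI[of _ trivializer])
      (simp add: mult_coboundary_eq_1_iff[OF normalized_trivializer])
qed

end
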